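(* Let $m,n$ be positive integers. The vertices of $P(m,n)$ are exactly the $m\times n$ sign matrices.
   Context: A sign matrix is a matrix with entries in $\{-1,0,1\}$ all of whose column partial sums from the top $\sum_{i'=1}^{i}M_{i'j}$ lie in $\{0,1\}$ and all of whose row partial sums from the left $\sum_{j'=1}^{j}M_{ij'}$ are nonnegative. $P(m,n)$ is the convex hull in $\mathbb{R}^{mn}$ of all $m\times n$ sign matrices. *)

theory Defs
  imports "HOL-Analysis.Analysis"
begin

text \<open>
  An \<open>m \<times> n\<close> real matrix is an element of \<^typ>\<open>real ^ 'n ^ 'm\<close>, where \<open>M $ i $ j\<close> is the entry
  in row \<open>i\<close> and column \<open>j\<close>, \<open>m = CARD('m)\<close> and \<open>n = CARD('n)\<close>. The linear orders on the finite
  index types are the orders of the rows from the top and of the columns from the left, so that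
  \<open>'m\<close> and \<open>'n\<close> are order-isomorphic to \<open>{1..m}\<close> and \<open>{1..n}\<close>.
\<close>

definition sign_matrix :: "real ^ 'n::{finite,linorder} ^ 'm::{finite,linorder} \<Rightarrow> bool" where
  "sign_matrix M \<longleftrightarrow>
     (\<forall>i j. M $ i $ j \<in> {-1, 0, 1}) \<and>
     (\<forall>i j. (\<Sum>i'\<le>i. M $ i' $ j) \<in> {0, 1}) \<and>
     (\<forall>i j. (\<Sum>j'\<le>j. M $ i $ j') \<ge> 0)"

definition sign_matrix_polytope :: "(real ^ 'n::{finite,linorder} ^ 'm::{finite,linorder}) set" where
  "sign_matrix_polytope = convex hull {M. sign_matrix M}"

end

(* Column partial sums are linear in the matrix, determine it, and map sign matrices to 0/1
   matrices, hence the polytope into a unit cube. A sign matrix is therefore extreme because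
   its image is a vertex of that cube. *)
theory Submission
  imports Defs
begin

definition column_sum :: "real ^ 'n::{finite,linorder} ^ 'm::{finite,linorder} \<Rightarrow> 'm \<Rightarrow> 'n \<Rightarrow> real"
  where "column_sum M i j = (\<Sum>i'\<le>i. M $ i' $ j)"

lemma column_sum_convex_combination:
  "column_sum (u *\<^sub>R A + v *\<^sub>R B) i j = u * column_sum A i j + v * column_sum B i j"
  by (simp add: column_sum_def sum.distrib sum_distrib_left)

text \<open>Each entry is the column sum ending at its row minus the entries above it, so the
  entries are recovered from the top row downwards.\<close>

lemma column_sum_inject:
  fixes A B :: "real ^ 'n::{finite,linorder} ^ 'm::{finite,linorder}"
  assumes eq: "\<And>i j. column_sum A i j = column_sum B i j"
  shows "A = B"
proof -
  have "A $ i $ j = B $ i $ j" for i j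
  \<comment> \<open>The row type is only a finite linear order, so the induction measure is the
    number of rows strictly above \<open>i\<close>.\<close>
  proof (induction "card {..<i}" arbitrary: i rule: less_induct)
    case less
    have "A $ k $ j = B $ k $ j" if "k < i" for k
      using that by (intro less psubset_card_mono) auto
    then have "(\<Sum>k<i. A $ k $ j) = (\<Sum>k<i. B $ k $ j)"
      by simp
    moreover have "column_sum M i j = M $ i $ j + (\<Sum>k<i. M $ k $ j)"
      for M :: "real ^ 'n::{finite,linorder} ^ 'm::{finite,linorder}"
      by (simp add: column_sum_def ivl_disj_un_singleton(2)[symmetric])
    ultimately show ?case
      using eq[of i j] by simp
  qed
  then show ?thesis
    by (simp add: vec_eq_iff)
qed

lemma column_sum_sign_matrix: "sign_matrix M \<Longrightarrow> column_sum M i j \<in> {0, 1}"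
  by (simp add: sign_matrix_def column_sum_def)

text \<open>For fixed \<open>i\<close> and \<open>j\<close>, the bounds cut out the preimage of an
  interval under a linear functional. This set is convex and contains all sign matrices, hence also
  their hull.\<close>

lemma column_sum_sign_matrix_polytope:
  fixes M :: "real ^ 'n::{finite,linorder} ^ 'm::{finite,linorder}"
  assumes "M \<in> sign_matrix_polytope"
  shows "column_sum M i j \<in> {0..1}"
proof -
  let ?C = "{M :: real ^ 'n::{finite,linorder} ^ 'm::{finite,linorder}. column_sum M i j \<in> {0..1}}"
  have "convex ?C"
  proof (rule convexI)
    fix A B and u v :: real
    assume "A \<in> ?C" "B \<in> ?C" "0 \<le> u" "0 \<le> v" "u + v = 1"
    then show "u *\<^sub>R A + v *\<^sub>R B \<in> ?C"
      using convexD[OF convex_real_interval(5), of "column_sum A i j" 0 1 "column_sum B i j" u v]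
      by (simp add: column_sum_convex_combination)
  qed
  moreover have "{M. sign_matrix M} \<subseteq> ?C"
    by (auto dest: column_sum_sign_matrix[of _ i j])
  ultimately show ?thesis
    using assms hull_minimal[of "{M. sign_matrix M}" ?C convex]
    unfolding sign_matrix_polytope_def by blast
qed

text \<open>One-dimensional core: 0 and 1 are extreme points of the unit interval.\<close>

lemma convex_combination_endpoint:
  fixes a b u :: real
  assumes "a \<in> {0..1}" "b \<in> {0..1}" "0 < u" "u < 1" and "(1 - u) * a + u * b \<in> {0, 1}"
  shows "a = b"
proof -
  have zero: "x = 0 \<and> y = 0" if "0 \<le> x" "0 \<le> y" "(1 - u) * x + u * y = 0" for x y
    using that assms by (simp add: add_nonneg_eq_0_iff)
  \<comment> \<open>The reflection of \<open>x\<close> to \<open>1 - x\<close> turns the value 1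
    into the value 0, so \<open>zero\<close> settles both endpoints.\<close>
  consider "(1 - u) * a + u * b = 0" | "(1 - u) * (1 - a) + u * (1 - b) = 0"
    using assms(5) by (auto simp: algebra_simps)
  then show ?thesis
    using zero[of a b] zero[of "1 - a" "1 - b"] assms by cases auto
qed

lemma sign_matrix_extreme_point:
  assumes "sign_matrix M"
  shows "M extreme_point_of sign_matrix_polytope"
  unfolding extreme_point_of_def
proof (intro conjI ballI notI)
  show "M \<in> sign_matrix_polytope"
    using assms by (simp add: sign_matrix_polytope_def hull_inc)
next
  fix A B
  assume AB: "A \<in> sign_matrix_polytope" "B \<in> sign_matrix_polytope" and "M \<in> open_segment A B"
  then obtain u where "A \<noteq> B" and u: "0 < u" "u < 1" and M: "M = (1 - u) *\<^sub>R A + u *\<^sub>R B"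
    by (auto simp: in_segment)
  \<comment> \<open>Extremality is tested in each coordinate of the cube separately.\<close>
  have "column_sum A i j = column_sum B i j" for i j
    using convex_combination_endpoint[OF AB[THEN column_sum_sign_matrix_polytope] u]
      column_sum_sign_matrix[OF assms] unfolding M column_sum_convex_combination .
  with \<open>A \<noteq> B\<close> show False
    using column_sum_inject by blast
qed

theorem theorem4p3:
  shows "{V. V extreme_point_of
            (sign_matrix_polytope :: (real ^ 'n::{finite,linorder} ^ 'm::{finite,linorder}) set)}
         = {M. sign_matrix M}"
  \<comment> \<open>Conversely, an extreme point of any convex hull lies in the generating
    set.\<close>
  using sign_matrix_extreme_point extreme_point_of_convex_hull
  unfolding sign_matrix_polytope_def by blast

end
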